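(* Work over the max-plus semifield $\mathbb{R}_{\max,+}=(\mathbb{R}\cup\{-\infty\},\oplus,\otimes)$. Let $A,B,C$ be $n\times n$ matrices with entries in $\mathbb{R}\cup\{-\infty\}$ and let $f$ be a vector of order $n$. Consider the problem of finding regular vectors $x$ and vectors $y$ of order $n$ that $$\text{minimize } \mathbf{1}^{T}y\,y^{-}\mathbf{1}\quad\text{subject to}\quad Ax=y,\quad Bx\leq x,\quad Cy\leq x,\quad y\leq f .$$ Suppose that $A$ is a regular matrix, that the matrix $D=B\oplus CA$ satisfies $\mathrm{Tr}(D)\leq\mathbb{1}$, and that $f$ is a regular vector. Then the minimum value of the problem is equal to $$\Delta=(AD^{\ast}(\mathbf{1}^{T}AD^{\ast})^{-})^{-}\mathbf{1},$$ and it is attained if $$x=\alpha D^{\ast}(\mathbf{1}^{T}AD^{\ast})^{-},\qquad y=\alpha AD^{\ast}(\mathbf{1}^{T}AD^{\ast})^{-},\qquad \mathbb{0}<\alpha\leq(f^{-}AD^{\ast}(\mathbf{1}^{T}AD^{\ast})^{-})^{-1}.$$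
   Context: Max-plus semifield: on $\mathbb{X}=\mathbb{R}\cup\{-\infty\}$ put $a\oplus b=\max(a,b)$ and $a\otimes b=a+b$ (the sign $\otimes$ is omitted), with zero $\mathbb{0}=-\infty$ and identity $\mathbb{1}=0$ (the real number zero). For $a\in\mathbb{R}$, $a^{-1}=-a$. The order is the usual order on $\mathbb{R}\cup\{-\infty\}$, and it extends entrywise to vectors and matrices. Matrix addition, matrix multiplication and scalar multiplication follow the standard rules with $\oplus,\otimes$ in place of $+,\times$. $I$ is the identity matrix ($\mathbb{1}$ on the diagonal, $\mathbb{0}$ elsewhere); $D^{0}=I$, $D^{p}=D^{p-1}D$. Vectors are column vectors unless stated otherwise; $\mathbf{1}=(\mathbb{1},\ldots,\mathbb{1})^{T}$ is the vector of order $n$ all of whose entries equal $\mathbb{1}=0$. A matrix is row-regular (column-regular) if no row (column) consists entirely of $\mathbb{0}$, and regular if both. A vector is regular if none of its entries is $\mathbb{0}$. Multiplicative conjugate transpose: for an $m\times n$ matrix $M=(m_{ij})$, $M^{-}$ is the $n\times m$ matrix with entries $(M^{-})_{ij}=m_{ji}^{-1}$ if $m_{ji}\neq\mathbb{0}$ and $\mathbb{0}$ otherwise. In particular it turns column vectors into row vectors and row vectors into column vectors. For an $n\times n$ matrix $D$: $\mathrm{tr}\,D=\bigoplus_{i=1}^{n}d_{ii}$, $\mathrm{Tr}(D)=\bigoplus_{k=1}^{n}\mathrm{tr}(D^{k})$, and, when $\mathrm{Tr}(D)\leq\mathbb{1}$, $D^{\ast}=\bigoplus_{k=0}^{n-1}D^{k}$.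 *)

theory Defs
  imports "HOL-Analysis.Analysis"
begin

text \<open>
  The max-plus semifield, made an instance of \<^class>\<open>comm_semiring_1\<close> so that the library's matrices
  can be used over it. \<open>+\<close> is the maximum and \<open>*\<close> is the addition of reals; hence \<open>0\<close> stands
  for \<open>-\<infinity>\<close> and \<open>1\<close> for the real number zero.
\<close>

datatype maxplus = NegInf | Fin real

instantiation maxplus :: linorder
begin

fun less_eq_maxplus :: "maxplus \<Rightarrow> maxplus \<Rightarrow> bool" where
  "NegInf \<le> b \<longleftrightarrow> True"
| "Fin r \<le> NegInf \<longleftrightarrow> False"
| "Fin r \<le> Fin s \<longleftrightarrow> r \<le> s"

definition less_maxplus :: "maxplus \<Rightarrow> maxplus \<Rightarrow> bool" where
  "a < b \<longleftrightarrow> a \<le> b \<and> \<not> b \<le> (a::maxplus)"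

instance
proof
  fix a b c :: maxplus
  show "a < b \<longleftrightarrow> a \<le> b \<and> \<not> b \<le> a" by (rule less_maxplus_def)
  show "a \<le> a" by (cases a) auto
  show "a \<le> c" if "a \<le> b" "b \<le> c" using that by (cases a; cases b; cases c) auto
  show "a = b" if "a \<le> b" "b \<le> a" using that by (cases a; cases b) auto
  show "a \<le> b \<or> b \<le> a" by (cases a; cases b) auto
qed

end

instantiation maxplus :: comm_semiring_1
begin

definition zero_maxplus :: maxplus where "(0::maxplus) = NegInf"

definition one_maxplus :: maxplus where "(1::maxplus) = Fin 0"

definition plus_maxplus :: "maxplus \<Rightarrow> maxplus \<Rightarrow> maxplus" where
  "a + b = max a (b::maxplus)"

fun times_maxplus :: "maxplus \<Rightarrow> maxplus \<Rightarrow> maxplus" where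
  "Fin r * Fin s = Fin (r + s)"
| "NegInf * b = NegInf"
| "Fin r * NegInf = NegInf"

instance
proof
  fix a b c :: maxplus
  show "a * b * c = a * (b * c)" by (cases a; cases b; cases c) auto
  show "a * b = b * a" by (cases a; cases b) auto
  show "1 * a = a" by (cases a) (auto simp: one_maxplus_def)
  show "a + b + c = a + (b + c)" by (simp add: plus_maxplus_def max.assoc)
  show "a + b = b + a" by (simp add: plus_maxplus_def max.commute)
  show "0 + a = a" by (cases a) (auto simp: plus_maxplus_def zero_maxplus_def max_def)
  show "(a + b) * c = a * c + b * c"
    by (cases a; cases b; cases c) (auto simp: plus_maxplus_def max_def)
  show "0 * a = 0" by (simp add: zero_maxplus_def)
  show "a * 0 = 0" by (cases a) (auto simp: zero_maxplus_def)
  show "(0::maxplus) \<noteq> 1" by (simp add: zero_maxplus_def one_maxplus_def)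
qed

end

text \<open>The value \<open>inverse 0 = 0\<close> is only a convention making the operation total.\<close>

instantiation maxplus :: inverse
begin

fun inverse_maxplus :: "maxplus \<Rightarrow> maxplus" where
  "inverse (Fin r) = Fin (- r)"
| "inverse NegInf = NegInf"

definition divide_maxplus :: "maxplus \<Rightarrow> maxplus \<Rightarrow> maxplus" where
  "a div b = a * inverse (b::maxplus)"

instance ..

end

definition row_regular :: "maxplus^'n^'m \<Rightarrow> bool" where
  "row_regular M \<longleftrightarrow> (\<forall>i. \<exists>j. M $ i $ j \<noteq> 0)"

definition column_regular :: "maxplus^'n^'m \<Rightarrow> bool" where
  "column_regular M \<longleftrightarrow> (\<forall>j. \<exists>i. M $ i $ j \<noteq> 0)"

definition regular_matrix :: "maxplus^'n^'m \<Rightarrow> bool" where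
  "regular_matrix M \<longleftrightarrow> row_regular M \<and> column_regular M"

definition regular_vector :: "maxplus^'n \<Rightarrow> bool" where
  "regular_vector x \<longleftrightarrow> (\<forall>i. x $ i \<noteq> 0)"

text \<open>
  The multiplicative conjugate transpose of a vector. Row and column vectors share the type
  \<^typ>\<open>maxplus^'n\<close>, so the transposition is not visible here; it shows in the products used: a row
  vector acts on a matrix by \<open>v*\<close>, and a row times a column is \<^const>\<open>scalar_product\<close>.
\<close>

definition conj_vector :: "maxplus^'n \<Rightarrow> maxplus^'n" where
  "conj_vector x = (\<chi> i. if x $ i \<noteq> 0 then inverse (x $ i) else 0)"

text \<open>\<open>D ^ p\<close> on the library's matrix type is the entrywise power, hence a separate definition.\<close>

primrec matrix_power :: "maxplus^'n^'n \<Rightarrow> nat \<Rightarrow> maxplus^'n^'n" where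
  "matrix_power D 0 = mat 1"
| "matrix_power D (Suc p) = matrix_power D p ** D"

definition Tr :: "maxplus^'n^'n \<Rightarrow> maxplus" where
  "Tr D = (\<Sum>k = 1..CARD('n). trace (matrix_power D k))"

definition star :: "maxplus^'n^'n \<Rightarrow> maxplus^'n^'n" where
  "star D = (\<Sum>k = 0..CARD('n) - 1. matrix_power D k)"

text \<open>\<open>\<one>\<^sup>T y y\<^sup>- \<one>\<close>, a product of the two scalars \<open>\<one>\<^sup>T y\<close> and \<open>y\<^sup>- \<one>\<close>.\<close>

definition objective :: "maxplus^'n \<Rightarrow> maxplus" where
  "objective y = scalar_product (vec 1) y * scalar_product (conj_vector y) (vec 1)"

definition feasible ::
  "maxplus^'n^'n \<Rightarrow> maxplus^'n^'n \<Rightarrow> maxplus^'n^'n \<Rightarrow> maxplus^'n \<Rightarrow> maxplus^'n \<Rightarrow> maxplus^'n \<Rightarrow> bool" where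
  "feasible A B C f x y \<longleftrightarrow>
     regular_vector x \<and> A *v x = y \<and> B *v x \<le> x \<and> C *v y \<le> x \<and> y \<le> f"

definition is_minimum :: "'a::order set \<Rightarrow> 'a \<Rightarrow> bool" where
  "is_minimum S m \<longleftrightarrow> m \<in> S \<and> (\<forall>s\<in>S. m \<le> s)"

end

theory Submission
  imports Defs
begin

text \<open>
  Substituting \<open>y = A x\<close> merges \<open>B x \<le> x\<close> and \<open>C y \<le> x\<close> into the single inequality \<open>D x \<le> x\<close> with
  \<open>D = B \<oplus> C A\<close>. When no cycle of \<open>D\<close> has weight above
  \<open>\<one>\<close>, which is what \<open>Tr D \<le> \<one>\<close> says, a walk loses nothing by skipping its cycles, so that powers
  beyond the ones collected in \<open>D\<^sup>*\<close> contribute nothing (\<open>matrix_power_card_le_star\<close>). Consequently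
  \<open>D D\<^sup>* \<le> D\<^sup>*\<close> (\<open>mult_star_le_star\<close>): every \<open>D\<^sup>* w\<close> solves \<open>D x \<le> x\<close>. Conversely, a solution
  satisfies \<open>x = D\<^sup>* x\<close> (\<open>star_mult_eq_self\<close>).

  With \<open>M = A D\<^sup>*\<close> it remains to minimise the objective over vectors \<open>y = M x\<close>. For regular \<open>y\<close> the
  objective is the spread \<open>max y - min y\<close>, hence it is invariant under scaling, and it does not grow
  if \<open>y\<close> is enlarged while its maximum \<open>\<lambda> = \<one>\<^sup>T y\<close> is kept. Among the \<open>x\<close> with \<open>\<one>\<^sup>T M x = \<lambda>\<close> the
  largest is \<open>\<lambda> w\<close> with \<open>w = (\<one>\<^sup>T M)\<^sup>-\<close>, because each term of a max-plus sum is bounded by the sum and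
  multiplication by a nonzero scalar is invertible. The vector \<open>u = M w\<close> has maximum \<open>\<one>\<close>, so it
  attains the bound \<open>\<Delta> = u\<^sup>- \<one>\<close> (\<open>objective_lower_bound\<close>, \<open>objective_residual\<close>), and scaling it
  down far enough makes it respect \<open>y \<le> f\<close>.
\<close>

section \<open>Order and arithmetic of the semifield\<close>

text \<open>
  The order is the natural order of an idempotent semiring. With these instances the library's
  monotonicity lemmas for finite sums and products apply to max-plus expressions.
\<close>

instance maxplus :: canonically_ordered_monoid_add
proof
  fix a b :: maxplus
  show "a \<le> b \<longleftrightarrow> (\<exists>c. b = a + c)"
    unfolding plus_maxplus_def by (metis max.cobounded1 max_absorb2)
qed

instance maxplus :: ordered_comm_semiring
proof
  fix a b c :: maxplus
  assume "a \<le> b"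
  then show "c * a \<le> c * b"
    by (cases a; cases b; cases c) auto
qed

instance maxplus :: semiring_no_zero_divisors
proof
  fix a b :: maxplus
  assume "a \<noteq> 0" "b \<noteq> 0"
  then show "a * b \<noteq> 0"
    by (cases a; cases b) (auto simp: zero_maxplus_def)
qed

lemma maxplus_mult_mono:
  fixes a b c d :: maxplus
  assumes "a \<le> b" "c \<le> d"
  shows "a * c \<le> b * d"
  using assms by (intro mult_mono) auto

lemma mult_inverse_maxplus:
  fixes a :: maxplus
  assumes "a \<noteq> 0"
  shows "a * inverse a = 1"
  using assms by (cases a) (auto simp: zero_maxplus_def one_maxplus_def)

lemma inverse_maxplus_eq_0_iff [simp]:
  fixes a :: maxplus
  shows "inverse a = 0 \<longleftrightarrow> a = 0"
  by (cases a) (auto simp: zero_maxplus_def)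

lemma inverse_mult_maxplus:
  fixes a b :: maxplus
  shows "inverse (a * b) = inverse a * inverse b"
  by (cases a; cases b) auto

lemma inverse_maxplus_antimono:
  fixes a b :: maxplus
  assumes "a \<noteq> 0" "a \<le> b"
  shows "inverse b \<le> inverse a"
  using assms by (cases a; cases b) (auto simp: zero_maxplus_def)

lemma maxplus_le_mult_inverse_iff:
  fixes a b c :: maxplus
  assumes "a \<noteq> 0"
  shows "b \<le> c * inverse a \<longleftrightarrow> a * b \<le> c"
  using assms by (cases a; cases b; cases c) (auto simp: zero_maxplus_def)

text \<open>Addition is the maximum, so a sum is the least upper bound of its terms, and a nonempty sum
  equals one of them.\<close>

lemma maxplus_sum_le_iff:
  fixes g :: "'a \<Rightarrow> maxplus"
  assumes "finite K"
  shows "sum g K \<le> c \<longleftrightarrow> (\<forall>k\<in>K. g k \<le> c)"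
  using assms by induction (auto simp: plus_maxplus_def)

lemma maxplus_le_sum:
  fixes g :: "'a \<Rightarrow> maxplus"
  assumes "finite K" "k \<in> K"
  shows "g k \<le> sum g K"
  using assms by (intro member_le_sum) auto

lemma maxplus_sum_attained:
  fixes g :: "'a \<Rightarrow> maxplus"
  assumes "finite K" "K \<noteq> {}"
  obtains k where "k \<in> K" "sum g K = g k"
proof -
  have "\<exists>k\<in>K. sum g K = g k"
    using assms by (induction rule: finite_ne_induct) (auto simp: plus_maxplus_def max_def)
  then show thesis
    using that by blast
qed

section \<open>Matrices and vectors\<close>

lemma matrix_mult_term_le:
  fixes M :: "maxplus^'n^'m" and N :: "maxplus^'k^'n"
  shows "M $ i $ l * N $ l $ j \<le> (M ** N) $ i $ j"
  unfolding matrix_matrix_mult_def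
  by (simp add: maxplus_le_sum[where g = "\<lambda>l. M $ i $ l * N $ l $ j"])

lemma matrix_vector_mult_term_le:
  fixes M :: "maxplus^'n^'m" and x :: "maxplus^'n"
  shows "M $ i $ j * x $ j \<le> (M *v x) $ i"
  unfolding matrix_vector_mult_def
  by (simp add: maxplus_le_sum[where g = "\<lambda>j. M $ i $ j * x $ j"])

lemma matrix_vector_mult_mono:
  fixes M N :: "maxplus^'n^'m" and x z :: "maxplus^'n"
  assumes "M \<le> N" "x \<le> z"
  shows "M *v x \<le> N *v z"
  using assms
  by (auto simp: less_eq_vec_def matrix_vector_mult_def intro!: sum_mono maxplus_mult_mono)

lemma matrix_vector_mult_smult:
  fixes M :: "maxplus^'n^'m"
  shows "M *v (c *s x) = c *s (M *v x)"
  by (simp add: vec_eq_iff matrix_vector_mult_def sum_distrib_left mult_ac)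

lemma smult_mono:
  fixes x z :: "maxplus^'n"
  assumes "x \<le> z"
  shows "c *s x \<le> c *s z"
  using assms by (auto simp: less_eq_vec_def intro: maxplus_mult_mono)

lemma scalar_product_vector_matrix:
  fixes M :: "maxplus^'n^'m"
  shows "scalar_product v (M *v x) = scalar_product (v v* M) x"
  unfolding scalar_product_def matrix_vector_mult_def vector_matrix_mult_def
  by (simp add: sum_distrib_left sum_distrib_right mult_ac) (rule sum.swap)

lemma regular_vector_smult:
  assumes "c \<noteq> 0" "regular_vector x"
  shows "regular_vector (c *s x)"
  using assms by (auto simp: regular_vector_def)

lemma regular_vector_mono:
  assumes "regular_vector x" "x \<le> z"
  shows "regular_vector z"
  using assms unfolding regular_vector_def less_eq_vec_def by (metis le_zero_eq)

lemma regular_vector_matrix_mult: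
  assumes "row_regular M" "regular_vector x"
  shows "regular_vector (M *v x)"
  unfolding regular_vector_def
proof
  fix i
  obtain j where "M $ i $ j \<noteq> 0"
    using assms(1) by (auto simp: row_regular_def)
  then have "M $ i $ j * x $ j \<noteq> 0"
    using assms(2) by (simp add: regular_vector_def)
  then show "(M *v x) $ i \<noteq> 0"
    using matrix_vector_mult_term_le[of M i j x] by (metis le_zero_eq)
qed

lemma conj_vector_nth:
  "conj_vector x $ i = inverse (x $ i)"
  by (simp add: conj_vector_def)

lemma regular_conj_vector:
  assumes "regular_vector x"
  shows "regular_vector (conj_vector x)"
  using assms by (simp add: regular_vector_def conj_vector_nth)

lemma scalar_product_regular_neq_0:
  assumes "regular_vector v" "regular_vector x"
  shows "scalar_product v x \<noteq> 0"
proof -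
  have "v $ i * x $ i \<noteq> 0" "v $ i * x $ i \<le> scalar_product v x" for i
    using assms maxplus_le_sum[of UNIV i "\<lambda>i. v $ i * x $ i"]
    by (auto simp: regular_vector_def scalar_product_def)
  then show ?thesis
    by (metis le_zero_eq)
qed

section \<open>Weights of walks and powers of a matrix\<close>

lemma matrix_power_add:
  "matrix_power D (a + b) = matrix_power D a ** matrix_power D b"
  by (induction b) (auto simp: matrix_mul_assoc)

text \<open>
  An entry of a power is the largest weight of a walk of that length: no walk weighs more
  (\<open>walk_weight_le_matrix_power\<close>), and some walk weighs as much (\<open>matrix_power_attained_by_walk\<close>).
  The latter needs a positive length: a walk of length \<open>0\<close> weighs \<open>\<one>\<close>, but it cannot join distinct
  vertices.
\<close>

lemma walk_weight_le_matrix_power: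
  fixes D :: "maxplus^'n^'n"
  assumes "a \<le> b"
  shows "(\<Prod>t = a..<b. D $ p t $ p (Suc t)) \<le> matrix_power D (b - a) $ p a $ p b"
  using assms
proof (induction b rule: dec_induct)
  case base
  then show ?case
    by (simp add: mat_def)
next
  case (step b)
  have "(\<Prod>t = a..<Suc b. D $ p t $ p (Suc t))
      \<le> matrix_power D (b - a) $ p a $ p b * D $ p b $ p (Suc b)"
    using step by (simp add: maxplus_mult_mono)
  also have "\<dots> \<le> matrix_power D (Suc b - a) $ p a $ p (Suc b)"
    using step matrix_mult_term_le[of "matrix_power D (b - a)" "p a" "p b" D "p (Suc b)"]
    by (simp add: Suc_diff_le)
  finally show ?case .
qed

lemma matrix_power_attained_by_walk:
  fixes D :: "maxplus^'n^'n"
  assumes "0 < k"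
  shows "\<exists>p. p 0 = i \<and> p k = j \<and> matrix_power D k $ i $ j = (\<Prod>t = 0..<k. D $ p t $ p (Suc t))"
  using assms
proof (induction k arbitrary: j rule: nat_induct_non_zero)
  case 1
  show ?case
    by (rule exI[of _ "\<lambda>t. if t = 0 then i else j"]) simp
next
  case (Suc k)
  obtain l where l: "matrix_power D (Suc k) $ i $ j = matrix_power D k $ i $ l * D $ l $ j"
    using maxplus_sum_attained[of UNIV "\<lambda>l. matrix_power D k $ i $ l * D $ l $ j"]
    by (auto simp: matrix_matrix_mult_def)
  obtain p where p: "p 0 = i" "p k = l"
      "matrix_power D k $ i $ l = (\<Prod>t = 0..<k. D $ p t $ p (Suc t))"
    using Suc.IH by blast
  show ?case
    by (rule exI[of _ "p(Suc k := j)"]) (use l p in \<open>simp cong: prod.cong_simp\<close>)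
qed

text \<open>\<open>Tr D \<le> \<one>\<close> says that no cycle of length at most \<open>n\<close> has a weight above \<open>\<one>\<close>.\<close>

lemma matrix_power_diagonal_le_Tr:
  fixes D :: "maxplus^'n^'n"
  assumes "1 \<le> k" "k \<le> CARD('n)"
  shows "matrix_power D k $ i $ i \<le> Tr D"
proof -
  have "matrix_power D k $ i $ i \<le> trace (matrix_power D k)"
    unfolding trace_def by (rule maxplus_le_sum) auto
  also have "\<dots> \<le> Tr D"
    unfolding Tr_def using assms by (intro maxplus_le_sum) auto
  finally show ?thesis .
qed

section \<open>The star of a matrix\<close>

lemma matrix_power_le_star_entry:
  fixes D :: "maxplus^'n^'n"
  assumes "k < CARD('n)"
  shows "matrix_power D k $ i $ j \<le> star D $ i $ j"
  unfolding star_def sum_component using assms by (intro maxplus_le_sum) auto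

lemma mat_1_le_star:
  fixes D :: "maxplus^'n^'n"
  shows "mat 1 \<le> star D"
  using matrix_power_le_star_entry[of 0 D] by (simp add: less_eq_vec_def)

text \<open>
  A walk with \<open>n\<close> steps visits \<open>n + 1\<close> vertices, so it repeats one. Cutting out the cycle between two
  visits removes a factor of weight at most \<open>\<one>\<close> and leaves a walk of fewer than \<open>n\<close> steps.
\<close>

lemma matrix_power_card_le_star:
  fixes D :: "maxplus^'n^'n"
  assumes "Tr D \<le> 1"
  shows "matrix_power D CARD('n) $ i $ j \<le> star D $ i $ j"
proof -
  let ?n = "CARD('n)"
  obtain p where p: "p 0 = i" "p ?n = j"
      "matrix_power D ?n $ i $ j = (\<Prod>t = 0..<?n. D $ p t $ p (Suc t))"
    using matrix_power_attained_by_walk[of ?n i j D] by auto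
  have "\<not> inj_on p {0..?n}"
  proof
    assume "inj_on p {0..?n}"
    then have "card {0..?n} \<le> ?n"
      by (intro card_inj_on_le[where f = p]) auto
    then show False
      by simp
  qed
  then obtain a b where ab: "a < b" "b \<le> ?n" "p a = p b"
    by (auto simp: inj_on_def) (metis linorder_neqE_nat)
  let ?W = "\<lambda>s t. \<Prod>r = s..<t. D $ p r $ p (Suc r)"
  have cycle: "?W a b \<le> 1"
  proof -
    have "?W a b \<le> matrix_power D (b - a) $ p a $ p a"
      using walk_weight_le_matrix_power[of a b D p] ab by simp
    also have "\<dots> \<le> Tr D"
      using ab by (intro matrix_power_diagonal_le_Tr) auto
    finally show ?thesis
      using assms by simp
  qed
  have "matrix_power D ?n $ i $ j = ?W 0 a * ?W a b * ?W b ?n"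
    using ab p(3) by (simp add: prod.atLeastLessThan_concat)
  also have "\<dots> \<le> ?W 0 a * 1 * ?W b ?n"
    using cycle by (intro maxplus_mult_mono) auto
  also have "\<dots> \<le> matrix_power D a $ i $ p a * matrix_power D (?n - b) $ p a $ j"
    using walk_weight_le_matrix_power[of 0 a D p] walk_weight_le_matrix_power[of b ?n D p] ab p
    by (auto intro: maxplus_mult_mono)
  also have "\<dots> \<le> matrix_power D (a + (?n - b)) $ i $ j"
    unfolding matrix_power_add by (rule matrix_mult_term_le)
  also have "\<dots> \<le> star D $ i $ j"
    using ab by (intro matrix_power_le_star_entry) auto
  finally show ?thesis .
qed

lemma mult_star_le_star:
  fixes D :: "maxplus^'n^'n"
  assumes "Tr D \<le> 1"
  shows "D ** star D \<le> star D"
proof -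
  have "D $ i $ l * star D $ l $ j \<le> star D $ i $ j" for i l j
  proof -
    have "D $ i $ l * matrix_power D k $ l $ j \<le> star D $ i $ j" if "k \<le> CARD('n) - 1" for k
    proof -
      have "D $ i $ l * matrix_power D k $ l $ j \<le> matrix_power D (1 + k) $ i $ j"
        unfolding matrix_power_add using matrix_mult_term_le[of D i l "matrix_power D k" j] by simp
      also have "\<dots> \<le> star D $ i $ j"
      proof (cases "1 + k = CARD('n)")
        case True
        then show ?thesis
          using matrix_power_card_le_star[OF assms] by metis
      next
        case False
        then have "1 + k < CARD('n)"
          using that zero_less_card_finite[where 'a = 'n] by linarith
        then show ?thesis
          by (rule matrix_power_le_star_entry)
      qed
      finally show ?thesis .
    qed
    then show ?thesis
      by (simp add: star_def sum_component sum_distrib_left maxplus_sum_le_iff)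
  qed
  then show ?thesis
    by (simp add: less_eq_vec_def matrix_matrix_mult_def maxplus_sum_le_iff)
qed

lemma matrix_power_mult_le_self:
  fixes D :: "maxplus^'n^'n"
  assumes "D *v x \<le> x"
  shows "matrix_power D k *v x \<le> x"
proof (induction k)
  case 0
  then show ?case
    by simp
next
  case (Suc k)
  have "matrix_power D (Suc k) *v x = matrix_power D k *v (D *v x)"
    by (simp add: matrix_vector_mul_assoc)
  also have "\<dots> \<le> matrix_power D k *v x"
    using assms by (intro matrix_vector_mult_mono) auto
  finally show ?case
    using Suc by (rule order_trans)
qed

lemma le_star_mult:
  fixes D :: "maxplus^'n^'n"
  shows "x \<le> star D *v x"
  using matrix_vector_mult_mono[OF mat_1_le_star order_refl, of x D] by simp

lemma star_mult_eq_self: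
  fixes D :: "maxplus^'n^'n"
  assumes "D *v x \<le> x"
  shows "star D *v x = x"
proof (rule order_antisym)
  have "matrix_power D k $ i $ j * x $ j \<le> x $ i" for k i j
    using matrix_vector_mult_term_le[of "matrix_power D k" i j x]
      matrix_power_mult_le_self[OF assms, of k]
    unfolding less_eq_vec_def by (meson order_trans)
  then show "star D *v x \<le> x"
    by (simp add: less_eq_vec_def matrix_vector_mult_def star_def sum_component
        sum_distrib_right maxplus_sum_le_iff)
qed (rule le_star_mult)

section \<open>Minimising the spread over the image of a matrix\<close>

lemma objective_smult:
  assumes "c \<noteq> 0"
  shows "objective (c *s y) = objective y"
proof -
  have "conj_vector (c *s y) = inverse c *s conj_vector y"
    by (simp add: vec_eq_iff conj_vector_nth inverse_mult_maxplus)
  then have "objective (c *s y) = (c * inverse c) * objective y"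
    by (simp add: objective_def scalar_product_def sum_distrib_left sum_distrib_right mult_ac)
  then show ?thesis
    using assms by (simp add: mult_inverse_maxplus)
qed

lemma regular_column_maxima:
  fixes M :: "maxplus^'n^'m"
  assumes "column_regular M"
  shows "regular_vector (vec 1 v* M)"
  unfolding regular_vector_def
proof
  fix j
  obtain i where "M $ i $ j \<noteq> 0"
    using assms by (auto simp: column_regular_def)
  moreover have "M $ i $ j \<le> (vec 1 v* M) $ j"
    unfolding vector_matrix_mult_def by (simp add: maxplus_le_sum[where g = "\<lambda>i. M $ i $ j"])
  ultimately show "(vec 1 v* M) $ j \<noteq> 0"
    by (metis le_zero_eq)
qed

lemma scalar_product_conj_vector:
  fixes q :: "maxplus^'n"
  assumes "regular_vector q"
  shows "scalar_product q (conj_vector q) = 1"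
proof -
  have "scalar_product q (conj_vector q) = (\<Sum>i\<in>(UNIV :: 'n set). 1)"
    using assms by (simp add: scalar_product_def conj_vector_nth mult_inverse_maxplus regular_vector_def)
  also have "\<dots> = 1"
    by (rule maxplus_sum_attained[of "UNIV :: 'n set" "\<lambda>_. 1"]) auto
  finally show ?thesis .
qed

text \<open>
  Since \<open>\<one>\<^sup>T M\<close> lists the column maxima, the residual vector \<open>M (\<one>\<^sup>T M)\<^sup>-\<close> is obtained by scaling all
  columns of \<open>M\<close> to maximum \<open>\<one>\<close> and adding them up; its own maximum is \<open>\<one>\<close>.
\<close>

lemma objective_residual:
  fixes M :: "maxplus^'n^'m"
  assumes "column_regular M"
  defines "u \<equiv> M *v conj_vector (vec 1 v* M)"
  shows "objective u = scalar_product (conj_vector u) (vec 1)"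
  unfolding objective_def
  using scalar_product_conj_vector[OF regular_column_maxima[OF assms(1)]]
  by (simp add: u_def scalar_product_vector_matrix)

text \<open>
  Put \<open>\<lambda> = \<one>\<^sup>T M x\<close>. Residuation of \<open>(\<one>\<^sup>T M) x \<le> \<lambda>\<close> gives \<open>x \<le> \<lambda> (\<one>\<^sup>T M)\<^sup>-\<close>, hence \<open>M x \<le> \<lambda> u\<close>. Passing
  to conjugates reverses the inequality, and the factor \<open>\<lambda>\<close> of the objective cancels.
\<close>

lemma objective_lower_bound:
  fixes M :: "maxplus^'n^'m"
  assumes "column_regular M" "regular_vector (M *v x)"
  defines "u \<equiv> M *v conj_vector (vec 1 v* M)"
  shows "scalar_product (conj_vector u) (vec 1) \<le> objective (M *v x)"
proof -
  let ?q = "vec 1 v* M" and ?y = "M *v x"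
  define c where "c = scalar_product (vec 1) ?y"
  have c: "c \<noteq> 0"
    unfolding c_def using assms(2)
    by (intro scalar_product_regular_neq_0) (auto simp: regular_vector_def vec_def)
  have q: "?q $ j \<noteq> 0" for j
    using regular_column_maxima[OF assms(1)] by (simp add: regular_vector_def)
  have "?q $ j * x $ j \<le> c" for j
    unfolding c_def scalar_product_vector_matrix unfolding scalar_product_def
    by (rule maxplus_le_sum) auto
  then have "x \<le> c *s conj_vector ?q"
    using q by (simp add: less_eq_vec_def conj_vector_nth maxplus_le_mult_inverse_iff)
  then have "?y \<le> c *s u"
    unfolding u_def matrix_vector_mult_smult[symmetric] by (intro matrix_vector_mult_mono) auto
  have "conj_vector u $ i \<le> c * conj_vector ?y $ i" for i
  proof -
    have "inverse (c * u $ i) \<le> inverse (?y $ i)"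
      using \<open>?y \<le> c *s u\<close> assms(2)
      by (intro inverse_maxplus_antimono) (auto simp: less_eq_vec_def regular_vector_def)
    then have "c * inverse (c * u $ i) \<le> c * inverse (?y $ i)"
      by (intro maxplus_mult_mono) auto
    moreover have "c * inverse (c * u $ i) = (c * inverse c) * inverse (u $ i)"
      by (simp add: inverse_mult_maxplus mult.assoc)
    ultimately show ?thesis
      using c by (simp add: conj_vector_nth mult_inverse_maxplus)
  qed
  then show ?thesis
    unfolding objective_def c_def[symmetric]
    by (simp add: scalar_product_def sum_distrib_left sum_mono)
qed

section \<open>The constrained problem\<close>

lemma feasible_iff:
  "feasible A B C f x y \<longleftrightarrow>
     regular_vector x \<and> y = A *v x \<and> (B + C ** A) *v x \<le> x \<and> y \<le> f"
proof -
  have "(B + C ** A) *v x \<le> x \<longleftrightarrow> B *v x \<le> x \<and> C *v (A *v x) \<le> x"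
    by (simp add: matrix_vector_mult_add_rdistrib matrix_vector_mul_assoc less_eq_vec_def
        plus_maxplus_def all_conj_distrib)
  then show ?thesis
    by (auto simp: feasible_def)
qed

lemma column_regular_mult_star:
  fixes A D :: "maxplus^'n^'n"
  assumes "column_regular A"
  shows "column_regular (A ** star D)"
  unfolding column_regular_def
proof
  fix j
  obtain i where "A $ i $ j \<noteq> 0"
    using assms by (auto simp: column_regular_def)
  moreover have "star D $ j $ j \<noteq> 0"
    using matrix_power_le_star_entry[of 0 D j j] by (auto simp: mat_def)
  ultimately have "A $ i $ j * star D $ j $ j \<noteq> 0"
    by simp
  then have "(A ** star D) $ i $ j \<noteq> 0"
    using matrix_mult_term_le[of A i j "star D" j] by (metis le_zero_eq)
  then show "\<exists>i. (A ** star D) $ i $ j \<noteq> 0" ..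
qed

lemma smult_le_of_le_inverse_scalar_product:
  fixes f u :: "maxplus^'n"
  assumes "regular_vector f" "regular_vector u"
    and "c \<le> inverse (scalar_product (conj_vector f) u)"
  shows "c *s u \<le> f"
proof -
  let ?s = "scalar_product (conj_vector f) u"
  have s: "?s \<noteq> 0"
    using assms by (intro scalar_product_regular_neq_0 regular_conj_vector)
  have "c * u $ i \<le> f $ i" for i
  proof -
    have "u $ i * inverse (f $ i) \<le> ?s"
      using maxplus_le_sum[of UNIV i "\<lambda>i. conj_vector f $ i * u $ i"]
      by (simp add: scalar_product_def conj_vector_nth mult.commute)
    then have "c * (u $ i * inverse (f $ i)) \<le> inverse ?s * ?s"
      by (intro maxplus_mult_mono assms(3))
    then have "(c * u $ i) * inverse (f $ i) \<le> 1"
      using s mult_inverse_maxplus[of ?s] by (simp add: mult_ac)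
    moreover have "f $ i \<noteq> 0"
      using assms(1) by (simp add: regular_vector_def)
    ultimately show ?thesis
      by (cases c; cases "u $ i"; cases "f $ i")
        (auto simp: zero_maxplus_def one_maxplus_def)
  qed
  then show ?thesis
    by (simp add: less_eq_vec_def)
qed

theorem theorem8:
  fixes A B C D :: "maxplus^'n^'n" and f :: "maxplus^'n" and \<Delta> :: maxplus
  assumes "regular_matrix A"
    and "D = B + C ** A"
    and "Tr D \<le> 1"
    and "regular_vector f"
    and "\<Delta> = scalar_product
               (conj_vector ((A ** star D) *v conj_vector (vec 1 v* (A ** star D)))) (vec 1)"
  shows "is_minimum {objective y | x y. feasible A B C f x y} \<Delta> \<and>
    (\<forall>\<alpha> x y.
       0 < \<alpha> \<and>
       \<alpha> \<le> inverse (scalar_product (conj_vector f)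
             ((A ** star D) *v conj_vector (vec 1 v* (A ** star D)))) \<and>
       x = \<alpha> *s (star D *v conj_vector (vec 1 v* (A ** star D))) \<and>
       y = \<alpha> *s ((A ** star D) *v conj_vector (vec 1 v* (A ** star D))) \<longrightarrow>
       feasible A B C f x y \<and> objective y = \<Delta>)"
proof -
  define w where "w = conj_vector (vec 1 v* (A ** star D))"
  define u where "u = (A ** star D) *v w"
  let ?s = "scalar_product (conj_vector f) u"
  have A: "row_regular A" "column_regular (A ** star D)"
    using assms(1) by (auto simp: regular_matrix_def intro: column_regular_mult_star)
  have u: "u = A *v (star D *v w)"
    by (simp add: u_def matrix_vector_mul_assoc)
  have "regular_vector w"
    unfolding w_def using A by (intro regular_conj_vector regular_column_maxima)
  then have reg: "regular_vector (star D *v w)" "regular_vector u"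
    unfolding u using A le_star_mult by (auto intro: regular_vector_mono regular_vector_matrix_mult)
  have \<Delta>: "\<Delta> = scalar_product (conj_vector u) (vec 1)"
    using assms(5) by (simp add: u_def w_def)
  have sol: "feasible A B C f (\<alpha> *s (star D *v w)) (\<alpha> *s u) \<and> objective (\<alpha> *s u) = \<Delta>"
    if "0 < \<alpha>" "\<alpha> \<le> inverse ?s" for \<alpha>
  proof
    have \<alpha>: "\<alpha> \<noteq> 0"
      using that(1) by auto
    have "D *v (star D *v w) \<le> star D *v w"
      unfolding matrix_vector_mul_assoc
      using mult_star_le_star[OF assms(3)] by (intro matrix_vector_mult_mono) auto
    then have "D *v (\<alpha> *s (star D *v w)) \<le> \<alpha> *s (star D *v w)"
      by (simp add: matrix_vector_mult_smult smult_mono)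
    then show "feasible A B C f (\<alpha> *s (star D *v w)) (\<alpha> *s u)"
      using \<alpha> reg that(2) assms(2,4) smult_le_of_le_inverse_scalar_product[of f u \<alpha>]
      by (simp add: feasible_iff regular_vector_smult u matrix_vector_mult_smult)
    show "objective (\<alpha> *s u) = \<Delta>"
      unfolding objective_smult[OF \<alpha>] \<Delta> u_def w_def by (rule objective_residual[OF A(2)])
  qed
  have lower: "\<Delta> \<le> objective y" if "feasible A B C f x y" for x y
  proof -
    have xy: "regular_vector x" "y = A *v x" "D *v x \<le> x"
      using that assms(2) by (auto simp: feasible_iff)
    then have y: "y = (A ** star D) *v x"
      by (simp add: star_mult_eq_self flip: matrix_vector_mul_assoc)
    have "regular_vector y"
      unfolding xy(2) using A(1) xy(1) by (rule regular_vector_matrix_mult)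
    then show ?thesis
      using objective_lower_bound[OF A(2), of x] by (simp add: \<Delta> u_def w_def y)
  qed
  (* The largest admissible scalar is itself nonzero, so the problem is feasible. *)
  have "?s \<noteq> 0"
    using assms(4) reg by (intro scalar_product_regular_neq_0 regular_conj_vector)
  then have "0 < inverse ?s"
    by (simp add: less_le)
  then have "\<exists>x y. feasible A B C f x y \<and> objective y = \<Delta>"
    using sol by blast
  then have "is_minimum {objective y | x y. feasible A B C f x y} \<Delta>"
    using lower by (auto simp: is_minimum_def)
  with sol show ?thesis
    unfolding u_def[symmetric] w_def[symmetric] by blast
qed

end
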